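(* Let $k\ge 1$ and $n>k+1$ be integers such that $n$ and $k+1$ are coprime, and put $s=(-1)^{n+k}$. Let $L=T^{-k-1}+\sum_{j=1}^k a_i^jT^{-j}\in\mathcal D_{k+1,n}$, with $a_i^1\ne0$ for all $i$, be superperiodic, and let $\mathcal L\in\mathcal D_{n-k-1,n}$ be the operator satisfying $$T^{-n}-s=(\mathcal L-s)(L+1)=(L+1)(\mathcal L-s).$$ Then $L$ and $\mathcal L$ commute: $[L,\mathcal L]=0$.
   Context: Difference operators act on sequences $\psi=(\psi_i)_{i\in\mathbb Z}$ of complex numbers; $(T\psi)_i=\psi_{i+1}$, and an operator $\sum_j a_i^jT^{-j}$ acts by $\psi\mapsto(\sum_j a_i^j\psi_{i-j})_i$. For $r\ge1$, $\mathcal D_{r,n}$ is the set of operators $L=T^{-r}+\sum_{j=1}^{r-1}a_i^jT^{-j}$ with $n$-periodic complex coefficients, $a_{i+n}^j=a_i^j$. An operator $L\in\mathcal D_{r,n}$ is superperiodic if every solution $\Psi$ of $(L+1)\Psi=0$ satisfies $\Psi_i=(-1)^{n+r-1}\Psi_{i-n}$ for all $i$. For superperiodic $L\in\mathcal D_{k+1,n}$ with $n,k+1$ coprime, an operator $\mathcal L$ as in the claim exists. *)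

theory Defs
  imports Complex_Main "HOL-Library.Function_Algebras"
begin

type_synonym sequence = "int \<Rightarrow> complex"

text \<open>
  Difference operators are identified with their action on sequences. Products of operators are
  compositions, written \<open>\<circ>\<close>; sums, differences and \<open>0\<close> are the pointwise ones.
  The pointwise \<open>*\<close>, \<open>1\<close> and numerals that the imported theory also puts on function
  types are not the operator product and scalars, so scalars are written with
  \<open>scalar\<close>, and the unit is \<open>scalar 1\<close>.
\<close>

type_synonym operator = "sequence \<Rightarrow> sequence"

text \<open>\<open>shift m\<close> is $T^m$ for an arbitrary integer \<open>m\<close>.\<close>

definition shift :: "int \<Rightarrow> operator" where
  "shift m = (\<lambda>\<psi> i. \<psi> (i + m))"

definition scalar :: "complex \<Rightarrow> operator" where
  "scalar c = (\<lambda>\<psi> i. c * \<psi> i)"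

definition commutator :: "operator \<Rightarrow> operator \<Rightarrow> operator" where
  "commutator A B = (A \<circ> B) - (B \<circ> A)"

lemma commutator_apply: "commutator A B \<psi> = A (B \<psi>) - B (A \<psi>)"
  by (simp add: commutator_def)

text \<open>The coefficient $a_i^j$ is \<open>a j i\<close>; only the values with $1 \le j \le r - 1$ matter.\<close>

definition diff_op :: "nat \<Rightarrow> (nat \<Rightarrow> sequence) \<Rightarrow> operator" where
  "diff_op r a =
     (\<lambda>\<psi> i. shift (- int r) \<psi> i + (\<Sum>j = 1..r - 1. a j i * shift (- int j) \<psi> i))"

definition diff_ops :: "nat \<Rightarrow> nat \<Rightarrow> operator set" where
  "diff_ops r n = {diff_op r a | a. \<forall>j\<in>{1..r - 1}. \<forall>i. a j (i + int n) = a j i}"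

text \<open>To be used for \<open>L \<in> diff_ops r n\<close> with \<open>r \<ge> 1\<close>.\<close>

definition superperiodic :: "nat \<Rightarrow> nat \<Rightarrow> operator \<Rightarrow> bool" where
  "superperiodic r n L \<longleftrightarrow>
     (\<forall>\<Psi>. (L + scalar 1) \<Psi> = 0 \<longrightarrow> (\<forall>i. \<Psi> i = (-1) ^ (n + r - 1) * \<Psi> (i - int n)))"

end

theory Submission
  imports Defs
begin

text \<open>
  Two linear operators commute as soon as scalar translates of them do: in
  \<open>(\<L> - s)(L + 1)\<close> and \<open>(L + 1)(\<L> - s)\<close> all terms other than \<open>\<L> L\<close> and \<open>L \<L>\<close> agree,
  because scalars are central. The two factorizations of $T^{-n} - s$ say that these translates
  commute. Operators are arbitrary maps on sequences here, so that a factor on the left need not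
  distribute over a sum on its right; this is where it matters that difference operators are
  linear.
\<close>

lemma diff_op_add: "diff_op r a (\<phi> + \<psi>) = diff_op r a \<phi> + diff_op r a \<psi>"
  by (rule ext) (simp add: diff_op_def shift_def algebra_simps sum.distrib)

lemma diff_op_scalar: "diff_op r a (scalar c \<psi>) = scalar c (diff_op r a \<psi>)"
  by (rule ext) (simp add: diff_op_def shift_def scalar_def algebra_simps sum_distrib_left)

text \<open>
  Additivity of \<open>B\<close> expands \<open>(B - c) \<circ> (A + d)\<close>; expanding the product in the other order needs
  additivity of \<open>A\<close>. In each product a scalar also has to be pulled through the left
  factor, which is where homogeneity enters.
\<close>

lemma commutator_eq_0_if_translates_commute:
  fixes A B :: operator
  assumes add: "\<And>\<phi> \<psi>. A (\<phi> + \<psi>) = A \<phi> + A \<psi>" "\<And>\<phi> \<psi>. B (\<phi> + \<psi>) = B \<phi> + B \<psi>"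
    and scalar: "\<And>x \<psi>. A (scalar x \<psi>) = scalar x (A \<psi>)" "\<And>x \<psi>. B (scalar x \<psi>) = scalar x (B \<psi>)"
    and translates: "(B - scalar c) \<circ> (A + scalar d) = (A + scalar d) \<circ> (B - scalar c)"
  shows "commutator A B = 0"
proof (intro ext)
  fix \<psi> i
  have left: "B (A \<psi> + scalar d \<psi>) = B (A \<psi>) + scalar d (B \<psi>)"
    by (simp add: add scalar)
  have "B \<psi> - scalar c \<psi> = B \<psi> + scalar (- c) \<psi>"
    by (rule ext) (simp add: scalar_def)
  then have right: "A (B \<psi> - scalar c \<psi>) = A (B \<psi>) + scalar (- c) (A \<psi>)"
    by (simp only: add scalar)
  from fun_cong[OF fun_cong[OF translates, of \<psi>], of i]
  show "commutator A B \<psi> i = 0 \<psi> i"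
    by (simp add: left right commutator_apply) (simp add: scalar_def algebra_simps)
qed

theorem corollary1p5:
  fixes k n :: nat and s :: complex and a :: "nat \<Rightarrow> sequence" and L \<L> :: operator
  assumes "k \<ge> 1" and "n > k + 1" and "coprime n (k + 1)"
    and "s = (-1) ^ (n + k)"
    and "L = diff_op (k + 1) a" and "L \<in> diff_ops (k + 1) n"
    and "\<forall>i. a 1 i \<noteq> 0"
    and "superperiodic (k + 1) n L"
    and "\<L> \<in> diff_ops (n - k - 1) n"
    and "shift (- int n) - scalar s = (\<L> - scalar s) \<circ> (L + scalar 1)"
    and "shift (- int n) - scalar s = (L + scalar 1) \<circ> (\<L> - scalar s)"
  shows "commutator L \<L> = 0"
proof -
  obtain b where "\<L> = diff_op (n - k - 1) b"
    using \<open>\<L> \<in> diff_ops (n - k - 1) n\<close> by (auto simp: diff_ops_def)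
  moreover have "(\<L> - scalar s) \<circ> (L + scalar 1) = (L + scalar 1) \<circ> (\<L> - scalar s)"
    using assms(10,11) by (rule trans[OF sym])
  ultimately show ?thesis
    using \<open>L = diff_op (k + 1) a\<close>
    by (intro commutator_eq_0_if_translates_commute[where c = s and d = 1])
      (simp_all only: diff_op_add diff_op_scalar)
qed

end
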